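(* Let $p$ be a prime and $n\ge k\ge 1$ integers such that $s(n,k)$ is a minimum zero case. Then $\nu_p(s(n-1,k-1))=\nu_p(s(n,k))$ and $\epsilon_p(s(n-1,k-1))\equiv\epsilon_p(s(n,k)) \pmod p$.
   Context: $s(n,k)$ is the signed Stirling number of the first kind, defined by $x(x-1)\cdots(x-n+1)=\sum_k s(n,k)x^k$ (so $s(0,0)=1$ and $s(m,0)=0$ for $m\ge 1$). $\nu_p$ is the $p$-adic valuation, $\sigma_p(m)$ the base-$p$ digit sum, and $\epsilon_p(x)=p^{-\nu_p(x)}x$ the unit part of a nonzero rational $x$. $s(n,k)$ is called a minimum zero case if $\nu_p(s(n,k))=(\sigma_p(k-1)-\sigma_p(n-1))/(p-1)$. *)

theory Defs
  imports
    "HOL-Computational_Algebra.Computational_Algebra"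
    "HOL-Combinatorics.Stirling"
    "HOL-Library.Extended_Real"
begin

text \<open>
  The library's \<^const>\<open>stirling\<close> is the unsigned version; lemma
  \<open>stirling_signed_eq\<close> below relates the two.
\<close>

definition stirling_signed :: "nat \<Rightarrow> nat \<Rightarrow> int" where
  "stirling_signed n k = coeff (\<Prod>i<n. [:- int i, 1:]) k"

definition rat_ord :: "nat \<Rightarrow> rat \<Rightarrow> int" where
  "rat_ord p x = (case quotient_of x of (a, b) \<Rightarrow>
     int (multiplicity (int p) a) - int (multiplicity (int p) b))"

text \<open>
  The valuation takes the value \<open>\<infinity>\<close> at 0; \<^const>\<open>rat_ord\<close> is its integer value at a
  nonzero argument, and is meaningless at 0.
\<close>

definition padic_val :: "nat \<Rightarrow> rat \<Rightarrow> ereal" where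
  "padic_val p x = (if x = 0 then \<infinity> else ereal (of_int (rat_ord p x)))"

definition unit_part :: "nat \<Rightarrow> rat \<Rightarrow> rat" where
  "unit_part p x = of_nat p powi (- rat_ord p x) * x"

text \<open>
  Congruence modulo \<open>p\<close> of \<open>p\<close>-integral rationals: the difference lies in
  the maximal ideal of the localization of the integers at \<open>p\<close>.
\<close>

definition rat_cong :: "nat \<Rightarrow> rat \<Rightarrow> rat \<Rightarrow> bool" where
  "rat_cong p x y \<longleftrightarrow> padic_val p (x - y) \<ge> 1"

text \<open>
  The summation range is large enough because \<open>m < p ^ m\<close> for \<open>p \<ge> 2\<close>, so the
  digits at the positions \<open>i \<ge> m\<close> vanish.
\<close>

definition digit_sum :: "nat \<Rightarrow> nat \<Rightarrow> nat" where
  "digit_sum p m = (\<Sum>i<m. m div p ^ i mod p)"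

definition minimum_zero_case :: "nat \<Rightarrow> nat \<Rightarrow> nat \<Rightarrow> bool" where
  "minimum_zero_case p n k \<longleftrightarrow>
     padic_val p (of_int (stirling_signed n k)) =
       ereal ((real (digit_sum p (k - 1)) - real (digit_sum p (n - 1))) / (real p - 1))"

lemma stirling_signed_0 [simp]: "stirling_signed 0 k = (if k = 0 then 1 else 0)"
  by (simp add: stirling_signed_def)

lemma stirling_signed_Suc_0 [simp]: "stirling_signed (Suc n) 0 = 0"
  by (simp add: stirling_signed_def prod.lessThan_Suc_shift del: prod.lessThan_Suc)

lemma stirling_signed_Suc_Suc:
  "stirling_signed (Suc n) (Suc k) = stirling_signed n k - int n * stirling_signed n (Suc k)"
  by (simp add: stirling_signed_def mult.commute[of _ "[:_, _:]"])

lemma stirling_signed_eq: "stirling_signed n k = (- 1) ^ (n + k) * int (stirling n k)"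
  by (induction n k rule: stirling.induct)
     (simp_all add: stirling_signed_Suc_Suc algebra_simps)

end

theory Submission
  imports Defs
begin

text \<open>
  Put \<open>N = n - 1\<close> and \<open>K = k - 1\<close>. The series \<open>ln (1 + x) ^ K\<close> has coefficients
  \<open>K! s(N,K) / N!\<close>, and since \<open>(p - 1) \<nu>\<^sub>p(j) \<le> j - 1\<close> for \<open>j \<ge> 1\<close>, their valuations are at least
  \<open>-(N - K) / (p - 1)\<close>. The series \<open>ln (1 + x) ^ K / (1 + x)\<close>, with coefficients
  \<open>K! s(N+1,K+1) / N!\<close>, inherits this bound. The difference of the two has coefficients
  \<open>K! N s(N,K+1) / N!\<close>, which are up to sign the coefficients of index \<open>N - 1\<close> of the second series,
  so that here the bound improves by \<open>1 / (p - 1)\<close>. By Legendre's formula the minimum zero case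
  is the one in which \<open>s(N+1,K+1)\<close> attains the bound, and then \<open>s(N,K) - s(N+1,K+1)\<close> has strictly
  larger valuation.
\<close>

section \<open>Legendre's formula\<close>

lemma digit_sum_eq_sum_lessThan:
  assumes "p \<ge> 2" "m \<le> M"
  shows "digit_sum p m = (\<Sum>i<M. m div p ^ i mod p)"
  unfolding digit_sum_def
proof (rule sum.mono_neutral_left)
  show "\<forall>i\<in>{..<M} - {..<m}. m div p ^ i mod p = 0"
  proof
    fix i assume "i \<in> {..<M} - {..<m}"
    hence "m \<le> i" by simp
    also have "i < p ^ i" using assms by (intro power_gt_expt) auto
    finally show "m div p ^ i mod p = 0" by simp
  qed
qed (use assms in auto)

lemma digit_sum_rec:
  assumes "p \<ge> 2"
  shows "digit_sum p m = m mod p + digit_sum p (m div p)"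
proof -
  \<comment> \<open>With \<open>Suc m\<close> terms, splitting off digit 0 leaves \<open>m\<close>
    terms, still enough for \<open>m div p\<close>.\<close>
  have "digit_sum p m = (\<Sum>i<Suc m. m div p ^ i mod p)"
    using assms by (intro digit_sum_eq_sum_lessThan) auto
  also have "\<dots> = m mod p + (\<Sum>i<m. m div p div p ^ i mod p)"
    by (simp add: sum.lessThan_Suc_shift div_mult2_eq del: sum.lessThan_Suc)
  also have "(\<Sum>i<m. m div p div p ^ i mod p) = digit_sum p (m div p)"
    using assms by (intro digit_sum_eq_sum_lessThan [symmetric]) auto
  finally show ?thesis .
qed

text \<open>Adding 1 turns the trailing digits \<open>p - 1\<close> of \<open>m\<close> into 0 and
  raises the next digit by 1; the number of these trailing digits is the valuation of
  \<open>Suc m\<close>. The induction strips one digit at a time.\<close>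

lemma digit_sum_Suc:
  assumes "p \<ge> 2"
  shows "digit_sum p (Suc m) + (p - 1) * multiplicity p (Suc m) = digit_sum p m + 1"
proof (induction m rule: less_induct)
  case (less m)
  show ?case
  proof (cases "p dvd Suc m")
    case False
    hence "Suc m mod p = Suc (m mod p)" "Suc m div p = m div p"
      by (auto simp: mod_Suc div_Suc dvd_eq_mod_eq_0)
    thus ?thesis
      using False assms digit_sum_rec [of p m] digit_sum_rec [of p "Suc m"]
      by (simp add: not_dvd_imp_multiplicity_0)
  next
    case True
    then obtain q where q: "Suc m = p * q" by (elim dvdE)
    then obtain r where r: "q = Suc r" by (cases q) auto
    have m: "m = p * r + (p - 1)" using q r assms by simp
    have "m div p = r" "m mod p = p - 1"
      using assms by (simp_all add: m del: Nat.add_diff_assoc)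
    moreover have "1 * r \<le> p * r" using assms by (intro mult_right_mono) auto
    hence "r < m" using m assms by linarith
    moreover have "multiplicity p (Suc m) = Suc (multiplicity p (Suc r))"
      unfolding q r using assms by (intro multiplicity_times_same) auto
    moreover have "Suc m mod p = 0" "Suc m div p = Suc r"
      using q r assms by auto
    ultimately show ?thesis
      using less.IH [of r] assms digit_sum_rec [of p m] digit_sum_rec [of p "Suc m"]
      by (cases p) (simp_all add: algebra_simps)
  qed
qed

text \<open>Summing \<open>digit_sum_Suc\<close> over the factors of the factorial telescopes the
  digit sums.\<close>

lemma legendre_digit_sum:
  assumes "prime p"
  shows "(p - 1) * multiplicity p (fact m) + digit_sum p m = m"
proof (induction m)
  case 0
  show ?case by (simp add: digit_sum_def)
next
  case (Suc m)
  have "multiplicity p (fact (Suc m)) = multiplicity p (Suc m) + multiplicity p (fact m)"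
    using assms unfolding fact_Suc of_nat_id
    by (intro prime_elem_multiplicity_mult_distrib) auto
  thus ?case
    using Suc.IH digit_sum_Suc [OF prime_ge_2_nat [OF assms], of m]
    by (simp add: algebra_simps)
qed

text \<open>Controls the denominators \<open>j\<close> of the logarithm series:
  \<open>(p - 1) * v < p ^ v\<close> by induction on \<open>v\<close>, and \<open>p ^ v\<close>
  divides \<open>j\<close> when \<open>v\<close> is the valuation of \<open>j\<close>.\<close>

lemma mult_multiplicity_less:
  assumes "p \<ge> 2" "j > 0"
  shows "(p - 1) * multiplicity p j < j"
proof -
  have "(p - 1) * v < p ^ v" for v
  proof (induction v)
    case (Suc v)
    have "(p - 1) * Suc v < p ^ v + (p - 1)" using Suc.IH assms by simp
    also have "\<dots> \<le> p ^ v + (p - 1) * p ^ v"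
      using assms by (intro add_left_mono) (metis mult.right_neutral mult_le_mono2 one_le_power
        one_le_numeral le_trans)
    also have "\<dots> = p ^ Suc v" using assms by (cases p) auto
    finally show ?case .
  qed auto
  also have "p ^ multiplicity p j \<le> j"
    using assms by (intro dvd_imp_le multiplicity_dvd) auto
  finally show ?thesis .
qed

section \<open>The valuation of rational numbers\<close>

text \<open>Frees \<open>rat_ord\<close> from lowest terms: cross-multiplying with the reduced
  fraction \<open>c / d\<close> gives \<open>a * d = c * b\<close>, and valuations of integer
  products add.\<close>

lemma rat_ord_divide:
  assumes "prime p" "a \<noteq> 0" "b \<noteq> 0"
  shows "rat_ord p (of_int a / of_int b) =
    int (multiplicity (int p) a) - int (multiplicity (int p) b)"
proof -
  obtain c d where cd: "quotient_of (of_int a / of_int b) = (c, d)" by fastforce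
  have d: "d > 0" using quotient_of_denom_pos [OF cd] .
  have eq: "(of_int a / of_int b :: rat) = of_int c / of_int d"
    using quotient_of_div [OF cd] .
  hence c: "c \<noteq> 0" using assms d by auto
  have "(of_int (a * d) :: rat) = of_int (c * b)"
    using eq assms d by (simp add: field_simps)
  hence "a * d = c * b" by (simp only: of_int_eq_iff)
  hence "multiplicity (int p) (a * d) = multiplicity (int p) (c * b)" by simp
  hence "multiplicity (int p) a + multiplicity (int p) d =
    multiplicity (int p) c + multiplicity (int p) b"
    using assms c d by (simp add: prime_elem_multiplicity_mult_distrib)
  thus ?thesis by (simp add: rat_ord_def cd)
qed

lemma rat_ord_of_int:
  "rat_ord p (of_int a) = int (multiplicity (int p) a)"
  by (simp add: rat_ord_def)

lemma rat_ord_of_nat: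
  "rat_ord p (of_nat a) = int (multiplicity p a)"
  using rat_ord_of_int [of p "int a"] 
  by (simp add: multiplicity_def flip: of_nat_power)

lemma rat_ord_mult:
  assumes "prime p" "x \<noteq> 0" "y \<noteq> 0"
  shows "rat_ord p (x * y) = rat_ord p x + rat_ord p y"
proof -
  obtain a b c d where x: "x = of_int a / of_int b" "b > 0" and y: "y = of_int c / of_int d" "d > 0"
    by (metis quotient_of_div quotient_of_denom_pos surj_pair)
  have nz: "a \<noteq> 0" "c \<noteq> 0" "b \<noteq> 0" "d \<noteq> 0" using assms x y by auto
  have "x * y = of_int (a * c) / of_int (b * d)" using x y by simp
  thus ?thesis
    using assms nz
    by (simp add: x y rat_ord_divide prime_elem_multiplicity_mult_distrib del: of_int_mult)
qed

lemma rat_ord_inverse: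
  assumes "prime p" "x \<noteq> 0"
  shows "rat_ord p (inverse x) = - rat_ord p x"
  using rat_ord_mult [OF assms, of "inverse x"] assms rat_ord_of_int [of p 1] by simp

lemma rat_ord_minus:
  assumes "prime p"
  shows "rat_ord p (- x) = rat_ord p x"
  using rat_ord_mult [OF assms, of "- 1" x] rat_ord_of_int [of p "- 1"]
  by (cases "x = 0") (auto simp: multiplicity_unit_right)

lemma rat_ord_add_ge:
  assumes "prime p" "x + y \<noteq> 0" "x \<noteq> 0" "y \<noteq> 0"
  shows "rat_ord p (x + y) \<ge> min (rat_ord p x) (rat_ord p y)"
proof -
  obtain a b c d where x: "x = of_int a / of_int b" "b > 0" and y: "y = of_int c / of_int d" "d > 0"
    by (metis quotient_of_div quotient_of_denom_pos surj_pair)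
  have nz: "a \<noteq> 0" "c \<noteq> 0" "b \<noteq> 0" "d \<noteq> 0" using assms x y by auto
  let ?v = "multiplicity (int p)"
  have x': "x = of_int (a * d) / of_int (b * d)" and y': "y = of_int (c * b) / of_int (b * d)"
    using x y by (auto simp: field_simps)
  have xy: "x + y = of_int (a * d + c * b) / of_int (b * d)"
    unfolding x' y' by (simp add: add_divide_distrib)
  hence nz': "a * d + c * b \<noteq> 0" using assms(2) by (intro notI) simp
  have "int p ^ min (?v (a * d)) (?v (c * b)) dvd a * d + c * b"
    by (intro dvd_add multiplicity_dvd') auto
  hence "min (?v (a * d)) (?v (c * b)) \<le> ?v (a * d + c * b)"
    using nz' assms(1) prime_ge_2_nat [OF assms(1)] by (intro multiplicity_geI) auto
  moreover have "rat_ord p x = int (?v (a * d)) - int (?v (b * d))"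
    unfolding x' using assms nz by (intro rat_ord_divide) auto
  moreover have "rat_ord p y = int (?v (c * b)) - int (?v (b * d))"
    unfolding y' using assms nz by (intro rat_ord_divide) auto
  moreover have "rat_ord p (x + y) = int (?v (a * d + c * b)) - int (?v (b * d))"
    unfolding xy using assms nz nz' by (intro rat_ord_divide) auto
  ultimately show ?thesis by linarith
qed

lemma rat_ord_add_eq:
  assumes "prime p" "x \<noteq> 0" "y \<noteq> 0" "rat_ord p x < rat_ord p y"
  shows "x + y \<noteq> 0" "rat_ord p (x + y) = rat_ord p x"
proof -
  show *: "x + y \<noteq> 0"
  proof
    assume "x + y = 0"
    hence "y = - x" by (simp add: add_eq_0_iff)
    thus False using assms rat_ord_minus by auto
  qed
  show "rat_ord p (x + y) = rat_ord p x"
    \<comment> \<open>The second instance, for \<open>x = (x + y) + (- y)\<close>, excludes that the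
      sum has larger valuation than \<open>x\<close>.\<close>
    using rat_ord_add_ge [of p x y] rat_ord_add_ge [of p "x + y" "- y"] rat_ord_minus [of p y]
      assms * by auto
qed

section \<open>Lower bounds on the valuation in multiples of 1 / (p - 1)\<close>

text \<open>Equivalently \<open>\<nu>\<^sub>p(x) \<ge> -m / (p - 1)\<close>.\<close>

definition slope_bound :: "nat \<Rightarrow> int \<Rightarrow> rat \<Rightarrow> bool" where
  "slope_bound p m x \<longleftrightarrow> x = 0 \<or> 0 \<le> m + (int p - 1) * rat_ord p x"

lemma slope_bound_0 [simp]: "slope_bound p m 0"
  by (simp add: slope_bound_def)

lemma slope_bound_mono: "slope_bound p m x \<Longrightarrow> m \<le> m' \<Longrightarrow> slope_bound p m' x"
  by (auto simp: slope_bound_def)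

lemma slope_bound_minus: "prime p \<Longrightarrow> slope_bound p m (- x) \<longleftrightarrow> slope_bound p m x"
  by (simp add: slope_bound_def rat_ord_minus)

lemma slope_bound_add:
  assumes "prime p" "slope_bound p m x" "slope_bound p m y"
  shows "slope_bound p m (x + y)"
proof (cases "x = 0 \<or> y = 0 \<or> x + y = 0")
  case False
  have "min (rat_ord p x) (rat_ord p y) \<le> rat_ord p (x + y)"
    using rat_ord_add_ge assms(1) False by blast
  moreover have "int p - 1 \<ge> 0" using prime_ge_2_nat [OF assms(1)] by simp
  ultimately have "(int p - 1) * min (rat_ord p x) (rat_ord p y) \<le> (int p - 1) * rat_ord p (x + y)"
    by (intro mult_left_mono)
  thus ?thesis
    using assms(2,3) False by (auto simp: slope_bound_def min_def split: if_splits)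
qed (use assms in auto)

lemma slope_bound_diff:
  assumes "prime p" "slope_bound p m x" "slope_bound p m y"
  shows "slope_bound p m (x - y)"
  using slope_bound_add [of p m x "- y"] assms by (simp add: slope_bound_minus)

lemma slope_bound_sum:
  assumes "prime p" "\<And>i. i \<in> A \<Longrightarrow> slope_bound p m (f i)"
  shows "slope_bound p m (sum f A)"
  using assms(2)
  by (induction A rule: infinite_finite_induct) (auto intro: slope_bound_add [OF assms(1)])

lemma slope_bound_mult:
  assumes "prime p" "slope_bound p m x" "slope_bound p m' y"
  shows "slope_bound p (m + m') (x * y)"
proof (cases "x = 0 \<or> y = 0")
  case False
  thus ?thesis
    using assms rat_ord_mult [OF assms(1), of x y] by (simp add: slope_bound_def distrib_left)
qed auto

section \<open>Coefficients of the powers of the logarithm\<close>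

lemma slope_bound_fps_ln_nth:
  assumes "prime p" "j > 0"
  shows "slope_bound p (int j - 1) (fps_ln 1 $ j)"
proof -
  have p: "p \<ge> 2" using prime_ge_2_nat [OF assms(1)] .
  have "rat_ord p (inverse (of_nat j)) = - int (multiplicity p j)"
    using assms by (simp add: rat_ord_inverse rat_ord_of_nat)
  moreover have "(int p - 1) * int (multiplicity p j) < int j"
    using mult_multiplicity_less [OF p assms(2)] p
    by (metis of_nat_1 of_nat_diff of_nat_less_iff of_nat_mult prime_ge_1_nat assms(1))
  ultimately have "slope_bound p (int j - 1) (inverse (of_nat j))"
    by (simp add: slope_bound_def)
  moreover have "fps_ln 1 $ j = inverse (of_nat j) \<or> fps_ln 1 $ j = - inverse (of_nat j :: rat)"
    using assms(2) by (cases "even (j - 1)") (auto simp: fps_ln_nth divide_inverse)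
  ultimately show ?thesis using slope_bound_minus [OF assms(1)] by metis
qed

text \<open>The bounds add up in each term of the Cauchy product:
  \<open>(j - 1) + ((N - j) - K) = N - (K + 1)\<close>. The term \<open>j = 0\<close> vanishes
  because the logarithm has no constant term.\<close>

lemma slope_bound_fps_ln_power_nth:
  assumes "prime p"
  shows "slope_bound p (int N - int K) ((fps_ln 1 ^ K) $ N)"
proof (induction K arbitrary: N)
  case 0
  show ?case using rat_ord_of_int [of p 1] by (cases N) (auto simp: slope_bound_def)
next
  case (Suc K)
  have "slope_bound p (int N - int (Suc K)) (fps_ln 1 $ j * (fps_ln 1 ^ K) $ (N - j))"
    if "j \<in> {0..N}" for j
  proof (cases "j = 0")
    case False
    have "slope_bound p (int j - 1 + (int (N - j) - int K))
            (fps_ln 1 $ j * (fps_ln 1 ^ K) $ (N - j))"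
      using False by (intro slope_bound_mult slope_bound_fps_ln_nth Suc.IH assms) auto
    thus ?thesis using that by (simp add: of_nat_diff algebra_simps)
  qed auto
  thus ?case
    unfolding power_Suc fps_mult_nth by (intro slope_bound_sum assms)
qed

section \<open>Stirling numbers\<close>

text \<open>Both sides vanish at 0 for positive exponent and satisfy
  \<open>(1 + x) f' = (K + 1) g\<close>, with \<open>f\<close> the series for \<open>K + 1\<close>
  and \<open>g\<close> that for \<open>K\<close>. For the right-hand side this is the Stirling
  recurrence read on coefficients.\<close>

lemma fps_ln_power_eq_stirling_signed:
  "fps_ln 1 ^ K =
    Abs_fps (\<lambda>N. fact K * of_int (stirling_signed N K) / fact N :: 'a::field_char_0)"
proof (induction K)
  case 0
  have "stirling_signed N 0 = (if N = 0 then 1 else 0)" for N by (cases N) auto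
  thus ?case by (auto simp: fps_eq_iff)
next
  case (Suc K)
  define F :: "nat \<Rightarrow> 'a fps" where
    "F K = Abs_fps (\<lambda>N. fact K * of_int (stirling_signed N K) / fact N)" for K
  have "(1 + fps_X) * fps_deriv (F (Suc K)) = of_nat (Suc K) * F K"
  proof (rule fps_ext)
    fix N
    show "((1 + fps_X) * fps_deriv (F (Suc K))) $ N = (of_nat (Suc K) * F K) $ N"
    proof (cases N)
      case 0
      thus ?thesis
        by (simp add: F_def distrib_right stirling_signed_Suc_Suc fps_mult_of_nat_nth
              del: of_nat_Suc)
    next
      case (Suc M)
      have "((1 + fps_X) * fps_deriv (F (Suc K))) $ N =
        of_nat (Suc N) * F (Suc K) $ Suc N + of_nat N * F (Suc K) $ N"
        using Suc by (simp add: distrib_right del: of_nat_Suc)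
      also have "of_nat (Suc N) * F (Suc K) $ Suc N =
        fact (Suc K) * of_int (stirling_signed N K - int N * stirling_signed N (Suc K)) / fact N"
        by (simp add: F_def stirling_signed_Suc_Suc fact_Suc [of N] del: of_nat_Suc)
      also have "\<dots> + of_nat N * F (Suc K) $ N = of_nat (Suc K) * F K $ N"
        by (simp add: F_def field_simps)
      finally show ?thesis by (simp add: fps_mult_of_nat_nth del: of_nat_Suc)
    qed
  qed
  moreover have "(1 + fps_X) * fps_deriv (fps_ln 1 ^ Suc K) =
      of_nat (Suc K) * (fps_ln 1 ^ K :: 'a fps)"
  proof -
    have "(1 + fps_X) * inverse (1 + fps_X :: 'a fps) = 1"
      by (intro inverse_mult_eq_1') simp
    thus ?thesis
      by (simp add: fps_deriv_power' fps_ln_deriv mult.assoc mult.left_commute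
            del: of_nat_Suc power_Suc)
  qed
  moreover have "fps_ln 1 ^ K = F K" using Suc.IH by (simp add: F_def)
  moreover have "(1 + fps_X :: 'a fps) \<noteq> 0"
  proof
    assume "(1 + fps_X :: 'a fps) = 0"
    hence "(1 + fps_X :: 'a fps) $ 0 = 0" by simp
    thus False by simp
  qed
  ultimately have "fps_deriv (fps_ln 1 ^ Suc K) = fps_deriv (F (Suc K))"
    by (metis mult_left_cancel)
  moreover have "F (Suc K) $ 0 = 0" by (simp add: F_def)
  moreover have "(fps_ln 1 ^ Suc K) $ 0 = (0 :: 'a)" by simp
  ultimately show ?case by (simp add: fps_deriv_eq_iff F_def del: power_Suc)
qed

lemma slope_bound_stirling_signed:
  assumes "prime p"
  shows "slope_bound p (int N - int K) (fact K * of_int (stirling_signed N K) / fact N)"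
  using slope_bound_fps_ln_power_nth [OF assms, of N K]
  unfolding fps_ln_power_eq_stirling_signed by simp

text \<open>These are the coefficients of \<open>ln (1 + x) ^ K / (1 + x)\<close>. Instead of
  dividing series, the recurrence expresses each one as a coefficient of
  \<open>ln (1 + x) ^ K\<close> minus its predecessor, whose bound is the stronger one.\<close>

lemma slope_bound_stirling_signed_Suc_Suc:
  assumes "prime p"
  shows "slope_bound p (int N - int K) (fact K * of_int (stirling_signed (Suc N) (Suc K)) / fact N)"
proof (induction N)
  case 0
  show ?case using slope_bound_stirling_signed [OF assms, of 0 K]
    by (simp add: stirling_signed_Suc_Suc)
next
  case (Suc N)
  have "fact K * of_int (stirling_signed (Suc (Suc N)) (Suc K)) / fact (Suc N) =
    fact K * of_int (stirling_signed (Suc N) K) / fact (Suc N) -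
    (fact K * of_int (stirling_signed (Suc N) (Suc K)) / fact N :: rat)"
    unfolding stirling_signed_Suc_Suc [of "Suc N"] fact_Suc [of N]
    by (simp add: divide_simps right_diff_distrib mult_ac del: of_nat_Suc)
  moreover have "slope_bound p (int (Suc N) - int K)
      (fact K * of_int (stirling_signed (Suc N) (Suc K)) / fact N)"
    using Suc.IH by (rule slope_bound_mono) simp
  ultimately show ?case
    using slope_bound_diff [OF assms slope_bound_stirling_signed [OF assms]] by metis
qed

text \<open>By the recurrence \<open>t\<close> has a factor \<open>N\<close>, which reduces
  \<open>N!\<close> to \<open>(N - 1)!\<close>. The bound at index \<open>N - 1\<close> gains 1 over
  the one at \<open>N\<close>, hence the strict inequality; Legendre's formula for \<open>K!\<close>
  and \<open>N!\<close> brings in the digit sums.\<close>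

lemma rat_ord_stirling_signed_diff:
  fixes N K :: nat and t :: rat
  defines "t \<equiv> of_int (stirling_signed N K - stirling_signed (Suc N) (Suc K))"
  assumes "prime p" "t \<noteq> 0"
  shows "(int p - 1) * rat_ord p t > int (digit_sum p K) - int (digit_sum p N)"
proof -
  have t: "t = of_nat N * of_int (stirling_signed N (Suc K))"
    by (simp add: t_def stirling_signed_Suc_Suc)
  with assms obtain M where N: "N = Suc M" by (cases N) auto
  have "fact K * of_int (stirling_signed N (Suc K)) / fact M = fact K * t / fact N"
    unfolding t N fact_Suc by (simp add: divide_simps del: of_nat_Suc)
  hence "slope_bound p (int M - int K) (fact K * t / fact N)"
    using slope_bound_stirling_signed_Suc_Suc [OF assms(2), of M K] N by metis
  moreover have "rat_ord p (fact m) = int (multiplicity p (fact m))" for m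
    using rat_ord_of_nat [of p "fact m"] by simp
  hence "rat_ord p (fact K * t / fact N) =
      int (multiplicity p (fact K)) + rat_ord p t - int (multiplicity p (fact N))"
    using assms(2,3) by (simp add: divide_inverse rat_ord_mult rat_ord_inverse)
  moreover have "(int p - 1) * int (multiplicity p (fact m)) = int m - int (digit_sum p m)" for m
  proof -
    have "int ((p - 1) * multiplicity p (fact m) + digit_sum p m) = int m"
      using legendre_digit_sum [OF assms(2)] by presburger
    thus ?thesis using prime_ge_2_nat [OF assms(2)] by (simp add: of_nat_diff)
  qed
  ultimately show ?thesis
    using assms(3) N by (simp add: slope_bound_def distrib_left right_diff_distrib del: fact_Suc)
qed

section \<open>Passage to unit parts and conclusion\<close>

text \<open>A summand of larger valuation leaves the valuation of \<open>x\<close> unchanged, so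
  both unit parts use the same power of \<open>p\<close>. They differ by that power times
  \<open>t\<close>, whose valuation is a positive integer. The case \<open>t = 0\<close> is separate
  since \<open>rat_ord\<close> is meaningless there.\<close>

lemma unit_part_cong:
  assumes "prime p" "x \<noteq> 0" "t = 0 \<or> rat_ord p x < rat_ord p t"
  shows "padic_val p (x + t) = padic_val p x" "rat_cong p (unit_part p (x + t)) (unit_part p x)"
proof -
  have p: "of_nat p \<noteq> (0 :: rat)" using assms(1) by auto
  have ord: "x + t \<noteq> 0 \<and> rat_ord p (x + t) = rat_ord p x"
    using assms rat_ord_add_eq [of p x t] by (cases "t = 0") auto
  show "padic_val p (x + t) = padic_val p x"
    using ord assms by (simp add: padic_val_def)
  show "rat_cong p (unit_part p (x + t)) (unit_part p x)"
  proof (cases "t = 0")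
    case True
    thus ?thesis by (simp add: rat_cong_def padic_val_def)
  next
    case False
    have pow: "rat_ord p (of_nat p ^ m) = int m" for m
      using rat_ord_of_nat [of p "p ^ m"] assms(1) by simp
    have powi: "rat_ord p (of_nat p powi i) = i" for i
      using p assms(1) by (simp add: power_int_def rat_ord_inverse pow power_inverse)
    have "unit_part p (x + t) - unit_part p x = of_nat p powi (- rat_ord p x) * t"
      using ord by (simp add: unit_part_def algebra_simps)
    moreover have "rat_ord p (of_nat p powi (- rat_ord p x) * t) = rat_ord p t - rat_ord p x"
      using p False assms(1) by (simp add: rat_ord_mult powi)
    ultimately show ?thesis
      using False p assms(3) by (simp add: rat_cong_def padic_val_def)
  qed
qed

theorem theorem3p4:
  fixes p n k :: nat
  assumes "prime p" and "1 \<le> k" and "k \<le> n"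
    and "minimum_zero_case p n k"
  shows "padic_val p (of_int (stirling_signed (n - 1) (k - 1))) =
           padic_val p (of_int (stirling_signed n k)) \<and>
         rat_cong p (unit_part p (of_int (stirling_signed (n - 1) (k - 1))))
                    (unit_part p (of_int (stirling_signed n k)))"
proof -
  obtain N K where n: "n = Suc N" and k: "k = Suc K"
    using assms by (metis Suc_le_D One_nat_def le_trans)
  have p: "p \<ge> 2" using prime_ge_2_nat [OF assms(1)] .
  define x :: rat where "x = of_int (stirling_signed n k)"
  define t :: rat where "t = of_int (stirling_signed N K - stirling_signed (Suc N) (Suc K))"
  \<comment> \<open>The minimum zero case prescribes a finite valuation, so the Stirling number
    cannot be 0.\<close>
  have x: "x \<noteq> 0"
    and val: "real_of_int (rat_ord p x) =
      (real (digit_sum p K) - real (digit_sum p N)) / (real p - 1)"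
    using assms(4) by (auto simp: minimum_zero_case_def padic_val_def x_def n k split: if_splits)
  have "real_of_int ((int p - 1) * rat_ord p x) =
      real_of_int (int (digit_sum p K) - int (digit_sum p N))"
    using val p by (simp add: field_simps)
  hence eq: "(int p - 1) * rat_ord p x = int (digit_sum p K) - int (digit_sum p N)"
    by (simp only: of_int_eq_iff)
  have "rat_ord p x < rat_ord p t" if "t \<noteq> 0"
  proof -
    have "(int p - 1) * rat_ord p x < (int p - 1) * rat_ord p t"
      using rat_ord_stirling_signed_diff [OF assms(1), of N K] that eq by (simp add: t_def)
    thus ?thesis using p by (simp add: mult_less_cancel_left_pos)
  qed
  moreover have "of_int (stirling_signed (n - 1) (k - 1)) = x + t"
    by (simp add: x_def t_def n k)
  ultimately show ?thesis
    using unit_part_cong [OF assms(1) x, of t] by (auto simp: x_def)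
qed

end
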